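(* Let $\mathcal T$ be a big tt-category whose internal hom is triangulated in the first variable, i.e. $[-,A]\colon\mathcal T^{op}\to\mathcal T$ preserves triangles for all $A\in\mathcal T$. Let $\Gamma\colon S\to\mathrm{Ob}(\mathcal T)$ be a map from a topological space $S$ with $\Gamma_s\neq 0$ for all $s\in S$ (the induced support--cosupport pair is not required to be good). If $\mathcal T$ satisfies the local-to-global principle, then $\mathcal T$ satisfies the colocal-to-global principle.
   Context: A big tt-category is a rigidly-compactly generated tensor-triangulated category $\mathcal T=(\mathcal T,\otimes,1)$: a tensor-triangulated category with arbitrary coproducts (preserved by $\otimes$ in each variable), generated as a localizing subcategory by its compact objects, whose compact objects form an essentially small tensor-triangulated subcategory and coincide with the rigid objects. Its internal hom is $[-,-]\colon\mathcal T^{op}\times\mathcal T\to\mathcal T$, with $[X,-]$ right adjoint to $X\otimes-$. $\mathrm{loc}^\otimes(\mathcal A)$ is the smallest localizing tensor-ideal (triangulated subcategory closed under coproducts and under $X\otimes-$ for all $X\in\mathcal T$) containing $\mathcal A$; $\mathrm{coloc}^{\hom}(\mathcal A)$ is the smallest colocalizing left $\hom$-ideal (triangulated subcategory closed under products and under $[X,-]$ for all $X\in\mathcal T$) containing $\mathcal A$. The map $\Gamma$ induces the support $\mathrm s_\Gamma(X)=\{s\mid\Gamma_s\otimes X\neq0\}$ and cosupport $\mathrm c_\Gamma(X)=\{s\mid[\Gamma_s,X]\neq0\}$. With respect to $\Gamma$: $\mathcal T$ satisfies the local-to-global principle if $\mathrm{loc}^\otimes(A)=\mathrm{loc}^\otimes(\Gamma_s\otimes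 A\mid s\in S)$ for all $A\in\mathcal T$; it satisfies the colocal-to-global principle if $\mathrm{coloc}^{\hom}(A)=\mathrm{coloc}^{\hom}([\Gamma_s,A]\mid s\in S)$ for all $A\in\mathcal T$. *)

theory Defs
  imports
    "HOL-Algebra.Product_Groups"
    "HOL-Algebra.Free_Abelian_Groups"
    "HOL-Library.Equipollence"
    "HOL-Analysis.Abstract_Topology"
begin

text \<open>Composition is written in the applicative order: \<open>g \<cdot> f\<close> means first \<open>f\<close>, then \<open>g\<close>.\<close>

record ('o, 'm) cat =
  Ob :: "'o set"
  Arr :: "'m set"
  Dom :: "'m \<Rightarrow> 'o"
  Cod :: "'m \<Rightarrow> 'o"
  Idt :: "'o \<Rightarrow> 'm"
  Comp :: "'m \<Rightarrow> 'm \<Rightarrow> 'm"  (infixl "\<cdot>\<index>" 70)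

definition Hom :: "('o, 'm, 'z) cat_scheme \<Rightarrow> 'o \<Rightarrow> 'o \<Rightarrow> 'm set" where
  "Hom C X Y = {f \<in> Arr C. Dom C f = X \<and> Cod C f = Y}"

locale category =
  fixes C :: "('o, 'm, 'z) cat_scheme" (structure)
  assumes Dom_in_Ob: "f \<in> Arr C \<Longrightarrow> Dom C f \<in> Ob C"
    and Cod_in_Ob: "f \<in> Arr C \<Longrightarrow> Cod C f \<in> Ob C"
    and Idt_in_Hom: "X \<in> Ob C \<Longrightarrow> Idt C X \<in> Hom C X X"
    and Comp_in_Hom: "\<lbrakk>f \<in> Hom C X Y; g \<in> Hom C Y Z\<rbrakk> \<Longrightarrow> g \<cdot> f \<in> Hom C X Z"
    and Comp_Idt: "f \<in> Hom C X Y \<Longrightarrow> f \<cdot> Idt C X = f"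
    and Idt_Comp: "f \<in> Hom C X Y \<Longrightarrow> Idt C Y \<cdot> f = f"
    and Comp_assoc: "\<lbrakk>f \<in> Hom C W X; g \<in> Hom C X Y; h \<in> Hom C Y Z\<rbrakk>
      \<Longrightarrow> h \<cdot> (g \<cdot> f) = (h \<cdot> g) \<cdot> f"

definition inverse_arrows :: "('o, 'm, 'z) cat_scheme \<Rightarrow> 'm \<Rightarrow> 'm \<Rightarrow> bool" where
  "inverse_arrows C f g \<longleftrightarrow> f \<in> Arr C \<and> g \<in> Hom C (Cod C f) (Dom C f)
     \<and> g \<cdot>\<^bsub>C\<^esub> f = Idt C (Dom C f) \<and> f \<cdot>\<^bsub>C\<^esub> g = Idt C (Cod C f)"

definition iso_arr :: "('o, 'm, 'z) cat_scheme \<Rightarrow> 'm \<Rightarrow> bool" where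
  "iso_arr C f \<longleftrightarrow> (\<exists>g. inverse_arrows C f g)"

definition inv_arr :: "('o, 'm, 'z) cat_scheme \<Rightarrow> 'm \<Rightarrow> 'm" where
  "inv_arr C f = (THE g. inverse_arrows C f g)"

definition isomorphic :: "('o, 'm, 'z) cat_scheme \<Rightarrow> 'o \<Rightarrow> 'o \<Rightarrow> bool" where
  "isomorphic C X Y \<longleftrightarrow> (\<exists>f \<in> Hom C X Y. iso_arr C f)"

definition zero_object :: "('o, 'm, 'z) cat_scheme \<Rightarrow> 'o \<Rightarrow> bool" where
  "zero_object C Z \<longleftrightarrow> Z \<in> Ob C \<and> (\<forall>X \<in> Ob C. (\<exists>!f. f \<in> Hom C Z X) \<and> (\<exists>!f. f \<in> Hom C X Z))"

definition is_coproduct ::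
    "('o, 'm, 'z) cat_scheme \<Rightarrow> 'i set \<Rightarrow> ('i \<Rightarrow> 'o) \<Rightarrow> 'o \<Rightarrow> ('i \<Rightarrow> 'm) \<Rightarrow> bool" where
  "is_coproduct C I X P \<iota> \<longleftrightarrow>
     P \<in> Ob C \<and> (\<forall>i \<in> I. X i \<in> Ob C \<and> \<iota> i \<in> Hom C (X i) P)
     \<and> (\<forall>Y \<in> Ob C. \<forall>f. (\<forall>i \<in> I. f i \<in> Hom C (X i) Y)
          \<longrightarrow> (\<exists>!h. h \<in> Hom C P Y \<and> (\<forall>i \<in> I. h \<cdot>\<^bsub>C\<^esub> \<iota> i = f i)))"

definition is_product ::
    "('o, 'm, 'z) cat_scheme \<Rightarrow> 'i set \<Rightarrow> ('i \<Rightarrow> 'o) \<Rightarrow> 'o \<Rightarrow> ('i \<Rightarrow> 'm) \<Rightarrow> bool" where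
  "is_product C I X P \<pi> \<longleftrightarrow>
     P \<in> Ob C \<and> (\<forall>i \<in> I. X i \<in> Ob C \<and> \<pi> i \<in> Hom C P (X i))
     \<and> (\<forall>Y \<in> Ob C. \<forall>f. (\<forall>i \<in> I. f i \<in> Hom C Y (X i))
          \<longrightarrow> (\<exists>!h. h \<in> Hom C Y P \<and> (\<forall>i \<in> I. \<pi> i \<cdot>\<^bsub>C\<^esub> h = f i)))"

record ('o, 'm, 'p, 'n) func =
  FOb :: "'o \<Rightarrow> 'p"
  FArr :: "'m \<Rightarrow> 'n"

definition is_functor ::
    "('o, 'm, 'z) cat_scheme \<Rightarrow> ('p, 'n, 'y) cat_scheme \<Rightarrow> ('o, 'm, 'p, 'n) func \<Rightarrow> bool" where
  "is_functor C D F \<longleftrightarrow>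
     (\<forall>X \<in> Ob C. FOb F X \<in> Ob D \<and> FArr F (Idt C X) = Idt D (FOb F X))
     \<and> (\<forall>X Y. \<forall>f \<in> Hom C X Y. FArr F f \<in> Hom D (FOb F X) (FOb F Y))
     \<and> (\<forall>X Y Z. \<forall>f \<in> Hom C X Y. \<forall>g \<in> Hom C Y Z.
          FArr F (g \<cdot>\<^bsub>C\<^esub> f) = FArr F g \<cdot>\<^bsub>D\<^esub> FArr F f)"

definition func_comp ::
    "('p, 'n, 'q, 'l) func \<Rightarrow> ('o, 'm, 'p, 'n) func \<Rightarrow> ('o, 'm, 'q, 'l) func" where
  "func_comp G F = \<lparr>FOb = FOb G \<circ> FOb F, FArr = FArr G \<circ> FArr F\<rparr>"

definition is_equivalence ::
    "('o, 'm, 'z) cat_scheme \<Rightarrow> ('p, 'n, 'y) cat_scheme \<Rightarrow> ('o, 'm, 'p, 'n) func \<Rightarrow> bool" where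
  "is_equivalence C D F \<longleftrightarrow> is_functor C D F
     \<and> (\<forall>X \<in> Ob C. \<forall>Y \<in> Ob C. bij_betw (FArr F) (Hom C X Y) (Hom D (FOb F X) (FOb F Y)))
     \<and> (\<forall>Y \<in> Ob D. \<exists>X \<in> Ob C. isomorphic D (FOb F X) Y)"

definition natural_iso ::
    "('o, 'm, 'z) cat_scheme \<Rightarrow> ('p, 'n, 'y) cat_scheme
      \<Rightarrow> ('o, 'm, 'p, 'n) func \<Rightarrow> ('o, 'm, 'p, 'n) func \<Rightarrow> ('o \<Rightarrow> 'n) \<Rightarrow> bool" where
  "natural_iso C D F G \<tau> \<longleftrightarrow>
     (\<forall>X \<in> Ob C. \<tau> X \<in> Hom D (FOb F X) (FOb G X) \<and> iso_arr D (\<tau> X))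
     \<and> (\<forall>X Y. \<forall>f \<in> Hom C X Y. \<tau> Y \<cdot>\<^bsub>D\<^esub> FArr F f = FArr G f \<cdot>\<^bsub>D\<^esub> \<tau> X)"

definition opposite :: "('o, 'm, 'z) cat_scheme \<Rightarrow> ('o, 'm) cat" where
  "opposite C = \<lparr>Ob = Ob C, Arr = Arr C, Dom = Cod C, Cod = Dom C, Idt = Idt C,
     Comp = (\<lambda>g f. f \<cdot>\<^bsub>C\<^esub> g)\<rparr>"

record ('o, 'm) acat = "('o, 'm) cat" +
  Plus :: "'m \<Rightarrow> 'm \<Rightarrow> 'm"
  Zer :: "'o \<Rightarrow> 'o \<Rightarrow> 'm"

definition Hom_group :: "('o, 'm, 'z) acat_scheme \<Rightarrow> 'o \<Rightarrow> 'o \<Rightarrow> 'm monoid" where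
  "Hom_group C X Y = \<lparr>carrier = Hom C X Y, mult = Plus C, one = Zer C X Y\<rparr>"

definition Neg :: "('o, 'm, 'z) acat_scheme \<Rightarrow> 'm \<Rightarrow> 'm" where
  "Neg C f = inv\<^bsub>Hom_group C (Dom C f) (Cod C f)\<^esub> f"

locale additive_category = category C
  for C :: "('o, 'm, 'z) acat_scheme" (structure) +
  assumes Hom_comm_group: "\<lbrakk>X \<in> Ob C; Y \<in> Ob C\<rbrakk> \<Longrightarrow> comm_group (Hom_group C X Y)"
    and Comp_Plus: "\<lbrakk>f \<in> Hom C X Y; f' \<in> Hom C X Y; g \<in> Hom C Y Z\<rbrakk>
      \<Longrightarrow> g \<cdot> Plus C f f' = Plus C (g \<cdot> f) (g \<cdot> f')"
    and Plus_Comp: "\<lbrakk>f \<in> Hom C X Y; g \<in> Hom C Y Z; g' \<in> Hom C Y Z\<rbrakk>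
      \<Longrightarrow> Plus C g g' \<cdot> f = Plus C (g \<cdot> f) (g' \<cdot> f)"
    and zero_object_exists: "\<exists>Z. zero_object C Z"
    and binary_coproducts: "\<lbrakk>X \<in> Ob C; Y \<in> Ob C\<rbrakk>
      \<Longrightarrow> \<exists>P \<iota>. is_coproduct C (UNIV :: bool set) (\<lambda>b. if b then X else Y) P \<iota>"

definition preserves_sums ::
    "('o, 'm, 'z) acat_scheme \<Rightarrow> ('p, 'n, 'y) acat_scheme \<Rightarrow> ('o, 'm, 'p, 'n) func \<Rightarrow> bool" where
  "preserves_sums C D F \<longleftrightarrow> (\<forall>X Y. \<forall>f \<in> Hom C X Y. \<forall>g \<in> Hom C X Y.
     FArr F (Plus C f g) = Plus D (FArr F f) (FArr F g))"

text \<open>\<open>(f, g, h) \<in> Dist T\<close> encodes the distinguished triangle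
  \<open>X \<rightarrow> Y \<rightarrow> Z \<rightarrow> \<Sigma>X\<close> with arrows \<open>f\<close>, \<open>g\<close>, \<open>h\<close>; the objects are read off as domains.\<close>

record ('o, 'm) tricat = "('o, 'm) acat" +
  Shift :: "('o, 'm, 'o, 'm) func"
  Dist :: "('m \<times> 'm \<times> 'm) set"

abbreviation ShO :: "('o, 'm, 'z) tricat_scheme \<Rightarrow> 'o \<Rightarrow> 'o" where
  "ShO T \<equiv> FOb (Shift T)"

abbreviation ShA :: "('o, 'm, 'z) tricat_scheme \<Rightarrow> 'm \<Rightarrow> 'm" where
  "ShA T \<equiv> FArr (Shift T)"

definition triangle ::
    "('o, 'm, 'z) tricat_scheme \<Rightarrow> 'o \<Rightarrow> 'o \<Rightarrow> 'o \<Rightarrow> 'm \<Rightarrow> 'm \<Rightarrow> 'm \<Rightarrow> bool" where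
  "triangle T X Y Z f g h \<longleftrightarrow>
     X \<in> Ob T \<and> Y \<in> Ob T \<and> Z \<in> Ob T
     \<and> f \<in> Hom T X Y \<and> g \<in> Hom T Y Z \<and> h \<in> Hom T Z (ShO T X)"

locale triangulated_category = additive_category T
  for T :: "('o, 'm, 'z) tricat_scheme" (structure) +
  assumes Shift_equivalence: "is_equivalence T T (Shift T)"
    and Shift_additive: "preserves_sums T T (Shift T)"
    and Dist_triangle: "(f, g, h) \<in> Dist T \<Longrightarrow> \<exists>X Y Z. triangle T X Y Z f g h"
    and Dist_iso: "\<lbrakk>(f, g, h) \<in> Dist T;
        triangle T X Y Z f g h; triangle T X' Y' Z' f' g' h';
        a \<in> Hom T X X'; b \<in> Hom T Y Y'; c \<in> Hom T Z Z';
        iso_arr T a; iso_arr T b; iso_arr T c;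
        b \<cdot> f = f' \<cdot> a; c \<cdot> g = g' \<cdot> b; ShA T a \<cdot> h = h' \<cdot> c\<rbrakk>
      \<Longrightarrow> (f', g', h') \<in> Dist T"
    and Dist_Idt: "\<lbrakk>X \<in> Ob T; zero_object T Z\<rbrakk>
      \<Longrightarrow> (Idt T X, Zer T X Z, Zer T Z (ShO T X)) \<in> Dist T"
    and Dist_extend: "f \<in> Arr T \<Longrightarrow> \<exists>g h. (f, g, h) \<in> Dist T"
    and Dist_rotate: "triangle T X Y Z f g h
      \<Longrightarrow> (f, g, h) \<in> Dist T \<longleftrightarrow> (g, h, Neg T (ShA T f)) \<in> Dist T"
    and Dist_morphism: "\<lbrakk>(f, g, h) \<in> Dist T; (f', g', h') \<in> Dist T;
        triangle T X Y Z f g h; triangle T X' Y' Z' f' g' h';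
        a \<in> Hom T X X'; b \<in> Hom T Y Y'; b \<cdot> f = f' \<cdot> a\<rbrakk>
      \<Longrightarrow> \<exists>c \<in> Hom T Z Z'. c \<cdot> g = g' \<cdot> b \<and> ShA T a \<cdot> h = h' \<cdot> c"
    and Dist_octahedron: "\<lbrakk>f \<in> Hom T X Y; g \<in> Hom T Y Z;
        triangle T X Y U f f' f''; (f, f', f'') \<in> Dist T;
        triangle T X Z V (g \<cdot> f) k' k''; (g \<cdot> f, k', k'') \<in> Dist T;
        triangle T Y Z W g g' g''; (g, g', g'') \<in> Dist T\<rbrakk>
      \<Longrightarrow> \<exists>u \<in> Hom T U V. \<exists>v \<in> Hom T V W.
            (u, v, ShA T f' \<cdot> g'') \<in> Dist T
            \<and> u \<cdot> f' = k' \<cdot> g \<and> k'' \<cdot> u = f''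
            \<and> v \<cdot> k' = g' \<and> g'' \<cdot> v = ShA T f \<cdot> k''"

definition exact_functor ::
    "('o, 'm, 'z) tricat_scheme \<Rightarrow> ('p, 'n, 'y) tricat_scheme \<Rightarrow> ('o, 'm, 'p, 'n) func \<Rightarrow> bool" where
  "exact_functor T T' F \<longleftrightarrow> is_functor T T' F \<and> preserves_sums T T' F
     \<and> (\<exists>\<theta>. natural_iso T T' (func_comp F (Shift T)) (func_comp (Shift T') F) \<theta>
          \<and> (\<forall>f g h. (f, g, h) \<in> Dist T
               \<longrightarrow> (FArr F f, FArr F g, \<theta> (Dom T f) \<cdot>\<^bsub>T'\<^esub> FArr F h) \<in> Dist T'))"

text \<open>Exactness of \<open>F : T\<^sup>o\<^sup>p \<rightarrow> T'\<close>. The suspension of \<open>T\<^sup>o\<^sup>p\<close> is a quasi-inverse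
  \<open>\<Sigma>\<^sup>-\<^sup>1\<close> of \<open>\<Sigma>\<close>, so the structure isomorphism \<open>F \<Sigma>\<^sup>-\<^sup>1 \<cong> \<Sigma> F\<close> amounts to
  \<open>\<psi> : F \<cong> \<Sigma> F \<Sigma>\<close>, which avoids choosing \<open>\<Sigma>\<^sup>-\<^sup>1\<close>. The triangle \<open>X \<rightarrow> Y \<rightarrow> Z \<rightarrow> \<Sigma>X\<close> is sent to
  \<open>F Z \<rightarrow> F Y \<rightarrow> F X \<rightarrow> \<Sigma> F Z\<close>, whose last arrow is \<open>F X \<cong> \<Sigma> F \<Sigma> X\<close> followed by \<open>\<Sigma> F h\<close>.
  The sign conventions for the triangles of \<open>T\<^sup>o\<^sup>p\<close> differ by the sign of \<open>\<psi>\<close> only.\<close>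

definition contra_exact_functor ::
    "('o, 'm, 'z) tricat_scheme \<Rightarrow> ('p, 'n, 'y) tricat_scheme \<Rightarrow> ('o, 'm, 'p, 'n) func \<Rightarrow> bool" where
  "contra_exact_functor T T' F \<longleftrightarrow> is_functor (opposite T) T' F \<and> preserves_sums T T' F
     \<and> (\<exists>\<psi>. natural_iso (opposite T) T' F (func_comp (Shift T') (func_comp F (Shift T))) \<psi>
          \<and> (\<forall>f g h. (f, g, h) \<in> Dist T
               \<longrightarrow> (FArr F g, FArr F f, ShA T' (FArr F h) \<cdot>\<^bsub>T'\<^esub> \<psi> (Dom T f)) \<in> Dist T'))"

text \<open>Full, replete triangulated subcategories, given by their sets of objects.\<close>

definition triangulated_subcategory :: "('o, 'm, 'z) tricat_scheme \<Rightarrow> 'o set \<Rightarrow> bool" where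
  "triangulated_subcategory T L \<longleftrightarrow> L \<subseteq> Ob T
     \<and> (\<forall>Z. zero_object T Z \<longrightarrow> Z \<in> L)
     \<and> (\<forall>X \<in> L. \<forall>Y \<in> Ob T. isomorphic T X Y \<longrightarrow> Y \<in> L)
     \<and> (\<forall>X \<in> Ob T. ShO T X \<in> L \<longleftrightarrow> X \<in> L)
     \<and> (\<forall>X Y Z f g h. triangle T X Y Z f g h \<and> (f, g, h) \<in> Dist T
          \<longrightarrow> (X \<in> L \<and> Y \<in> L \<longrightarrow> Z \<in> L) \<and> (Y \<in> L \<and> Z \<in> L \<longrightarrow> X \<in> L) \<and> (X \<in> L \<and> Z \<in> L \<longrightarrow> Y \<in> L))"

record ('o, 'm) ttcat = "('o, 'm) tricat" +
  Unit :: "'o"  ("\<one>\<^sub>o\<index>")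
  TenO :: "'o \<Rightarrow> 'o \<Rightarrow> 'o"  (infixl "\<otimes>\<^sub>o\<index>" 75)
  TenA :: "'m \<Rightarrow> 'm \<Rightarrow> 'm"  (infixl "\<otimes>\<^sub>a\<index>" 75)
  Assoc :: "'o \<Rightarrow> 'o \<Rightarrow> 'o \<Rightarrow> 'm"
  LUnit :: "'o \<Rightarrow> 'm"
  RUnit :: "'o \<Rightarrow> 'm"
  Braid :: "'o \<Rightarrow> 'o \<Rightarrow> 'm"
  IHom :: "'o \<Rightarrow> 'o \<Rightarrow> 'o"
  Eval :: "'o \<Rightarrow> 'o \<Rightarrow> 'm"

definition tensor_left :: "('o, 'm, 'z) ttcat_scheme \<Rightarrow> 'o \<Rightarrow> ('o, 'm, 'o, 'm) func" where
  "tensor_left T X = \<lparr>FOb = (\<lambda>Y. X \<otimes>\<^sub>o\<^bsub>T\<^esub> Y), FArr = (\<lambda>f. Idt T X \<otimes>\<^sub>a\<^bsub>T\<^esub> f)\<rparr>"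

definition tensor_right :: "('o, 'm, 'z) ttcat_scheme \<Rightarrow> 'o \<Rightarrow> ('o, 'm, 'o, 'm) func" where
  "tensor_right T X = \<lparr>FOb = (\<lambda>Y. Y \<otimes>\<^sub>o\<^bsub>T\<^esub> X), FArr = (\<lambda>f. f \<otimes>\<^sub>a\<^bsub>T\<^esub> Idt T X)\<rparr>"

locale tt_category = triangulated_category T
  for T :: "('o, 'm, 'z) ttcat_scheme" (structure) +
  assumes Unit_in_Ob: "\<one>\<^sub>o \<in> Ob T"
    and TenO_in_Ob: "\<lbrakk>X \<in> Ob T; Y \<in> Ob T\<rbrakk> \<Longrightarrow> X \<otimes>\<^sub>o Y \<in> Ob T"
    and TenA_in_Hom: "\<lbrakk>f \<in> Hom T X X'; g \<in> Hom T Y Y'\<rbrakk>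
      \<Longrightarrow> f \<otimes>\<^sub>a g \<in> Hom T (X \<otimes>\<^sub>o Y) (X' \<otimes>\<^sub>o Y')"
    and TenA_Idt: "\<lbrakk>X \<in> Ob T; Y \<in> Ob T\<rbrakk> \<Longrightarrow> Idt T X \<otimes>\<^sub>a Idt T Y = Idt T (X \<otimes>\<^sub>o Y)"
    and TenA_Comp: "\<lbrakk>f \<in> Hom T X X'; f' \<in> Hom T X' X''; g \<in> Hom T Y Y'; g' \<in> Hom T Y' Y''\<rbrakk>
      \<Longrightarrow> (f' \<cdot> f) \<otimes>\<^sub>a (g' \<cdot> g) = (f' \<otimes>\<^sub>a g') \<cdot> (f \<otimes>\<^sub>a g)"
    and Assoc_iso: "\<lbrakk>X \<in> Ob T; Y \<in> Ob T; Z \<in> Ob T\<rbrakk>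
      \<Longrightarrow> Assoc T X Y Z \<in> Hom T (X \<otimes>\<^sub>o Y \<otimes>\<^sub>o Z) (X \<otimes>\<^sub>o (Y \<otimes>\<^sub>o Z)) \<and> iso_arr T (Assoc T X Y Z)"
    and LUnit_iso: "X \<in> Ob T \<Longrightarrow> LUnit T X \<in> Hom T (\<one>\<^sub>o \<otimes>\<^sub>o X) X \<and> iso_arr T (LUnit T X)"
    and RUnit_iso: "X \<in> Ob T \<Longrightarrow> RUnit T X \<in> Hom T (X \<otimes>\<^sub>o \<one>\<^sub>o) X \<and> iso_arr T (RUnit T X)"
    and Braid_in_Hom: "\<lbrakk>X \<in> Ob T; Y \<in> Ob T\<rbrakk> \<Longrightarrow> Braid T X Y \<in> Hom T (X \<otimes>\<^sub>o Y) (Y \<otimes>\<^sub>o X)"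
    and Assoc_natural: "\<lbrakk>f \<in> Hom T X X'; g \<in> Hom T Y Y'; h \<in> Hom T Z Z'\<rbrakk>
      \<Longrightarrow> Assoc T X' Y' Z' \<cdot> (f \<otimes>\<^sub>a g \<otimes>\<^sub>a h) = (f \<otimes>\<^sub>a (g \<otimes>\<^sub>a h)) \<cdot> Assoc T X Y Z"
    and LUnit_natural: "f \<in> Hom T X Y \<Longrightarrow> LUnit T Y \<cdot> (Idt T \<one>\<^sub>o \<otimes>\<^sub>a f) = f \<cdot> LUnit T X"
    and RUnit_natural: "f \<in> Hom T X Y \<Longrightarrow> RUnit T Y \<cdot> (f \<otimes>\<^sub>a Idt T \<one>\<^sub>o) = f \<cdot> RUnit T X"
    and Braid_natural: "\<lbrakk>f \<in> Hom T X X'; g \<in> Hom T Y Y'\<rbrakk>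
      \<Longrightarrow> Braid T X' Y' \<cdot> (f \<otimes>\<^sub>a g) = (g \<otimes>\<^sub>a f) \<cdot> Braid T X Y"
    and pentagon: "\<lbrakk>W \<in> Ob T; X \<in> Ob T; Y \<in> Ob T; Z \<in> Ob T\<rbrakk>
      \<Longrightarrow> Assoc T W X (Y \<otimes>\<^sub>o Z) \<cdot> Assoc T (W \<otimes>\<^sub>o X) Y Z
          = (Idt T W \<otimes>\<^sub>a Assoc T X Y Z) \<cdot> Assoc T W (X \<otimes>\<^sub>o Y) Z \<cdot> (Assoc T W X Y \<otimes>\<^sub>a Idt T Z)"
    and unit_triangle: "\<lbrakk>X \<in> Ob T; Y \<in> Ob T\<rbrakk>
      \<Longrightarrow> (Idt T X \<otimes>\<^sub>a LUnit T Y) \<cdot> Assoc T X \<one>\<^sub>o Y = RUnit T X \<otimes>\<^sub>a Idt T Y"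
    and hexagon: "\<lbrakk>X \<in> Ob T; Y \<in> Ob T; Z \<in> Ob T\<rbrakk>
      \<Longrightarrow> Assoc T Y Z X \<cdot> Braid T X (Y \<otimes>\<^sub>o Z) \<cdot> Assoc T X Y Z
          = (Idt T Y \<otimes>\<^sub>a Braid T X Z) \<cdot> Assoc T Y X Z \<cdot> (Braid T X Y \<otimes>\<^sub>a Idt T Z)"
    and Braid_symmetric: "\<lbrakk>X \<in> Ob T; Y \<in> Ob T\<rbrakk>
      \<Longrightarrow> Braid T Y X \<cdot> Braid T X Y = Idt T (X \<otimes>\<^sub>o Y)"
    and tensor_left_exact: "X \<in> Ob T \<Longrightarrow> exact_functor T T (tensor_left T X)"
    and tensor_right_exact: "X \<in> Ob T \<Longrightarrow> exact_functor T T (tensor_right T X)"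

text \<open>The internal hom is part of the data, given by the counit
  \<open>Eval T X A : X \<otimes> [X, A] \<rightarrow> A\<close> of the adjunction \<open>X \<otimes> - \<stileturn> [X, -]\<close>, which determines it up to
  unique isomorphism. It is a theorem (Brown representability) that a rigidly-compactly generated
  category has one. The functoriality of \<open>[-, -]\<close> in both variables is derived.\<close>

locale closed_tt_category = tt_category T
  for T :: "('o, 'm, 'z) ttcat_scheme" (structure) +
  assumes IHom_in_Ob: "\<lbrakk>X \<in> Ob T; A \<in> Ob T\<rbrakk> \<Longrightarrow> IHom T X A \<in> Ob T"
    and Eval_in_Hom: "\<lbrakk>X \<in> Ob T; A \<in> Ob T\<rbrakk> \<Longrightarrow> Eval T X A \<in> Hom T (X \<otimes>\<^sub>o IHom T X A) A"
    and Eval_universal: "\<lbrakk>X \<in> Ob T; Y \<in> Ob T; A \<in> Ob T; f \<in> Hom T (X \<otimes>\<^sub>o Y) A\<rbrakk>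
      \<Longrightarrow> \<exists>!g. g \<in> Hom T Y (IHom T X A) \<and> Eval T X A \<cdot> (Idt T X \<otimes>\<^sub>a g) = f"

definition transpose_arr :: "('o, 'm, 'z) ttcat_scheme \<Rightarrow> 'o \<Rightarrow> 'o \<Rightarrow> 'm \<Rightarrow> 'm" where
  "transpose_arr T X Y f = (THE g. g \<in> Hom T Y (IHom T X (Cod T f))
     \<and> Eval T X (Cod T f) \<cdot>\<^bsub>T\<^esub> (Idt T X \<otimes>\<^sub>a\<^bsub>T\<^esub> g) = f)"

text \<open>For \<open>f : X \<rightarrow> X'\<close> and \<open>a : A \<rightarrow> B\<close>, the arrow \<open>[f, a] : [X', A] \<rightarrow> [X, B]\<close>.\<close>

definition IHom_arr :: "('o, 'm, 'z) ttcat_scheme \<Rightarrow> 'm \<Rightarrow> 'm \<Rightarrow> 'm" where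
  "IHom_arr T f a =
     (let H = IHom T (Cod T f) (Dom T a)
      in transpose_arr T (Dom T f) H
           (a \<cdot>\<^bsub>T\<^esub> Eval T (Cod T f) (Dom T a) \<cdot>\<^bsub>T\<^esub> (f \<otimes>\<^sub>a\<^bsub>T\<^esub> Idt T H)))"

definition hom_into :: "('o, 'm, 'z) ttcat_scheme \<Rightarrow> 'o \<Rightarrow> ('o, 'm, 'o, 'm) func" where
  "hom_into T A = \<lparr>FOb = (\<lambda>X. IHom T X A), FArr = (\<lambda>f. IHom_arr T f (Idt T A))\<rparr>"

definition hom_triangulated_in_first_variable :: "('o, 'm, 'z) ttcat_scheme \<Rightarrow> bool" where
  "hom_triangulated_in_first_variable T \<longleftrightarrow>
     (\<forall>A \<in> Ob T. contra_exact_functor T T (hom_into T A))"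

text \<open>The canonical arrow \<open>[X, 1] \<otimes> Y \<rightarrow> [X, Y]\<close>; an object is rigid if it is invertible for
  all \<open>Y\<close>.\<close>

definition dual_tensor_arr :: "('o, 'm, 'z) ttcat_scheme \<Rightarrow> 'o \<Rightarrow> 'o \<Rightarrow> 'm" where
  "dual_tensor_arr T X Y =
     (let D = IHom T X \<one>\<^sub>o\<^bsub>T\<^esub>
      in transpose_arr T X (D \<otimes>\<^sub>o\<^bsub>T\<^esub> Y)
           (LUnit T Y \<cdot>\<^bsub>T\<^esub> (Eval T X \<one>\<^sub>o\<^bsub>T\<^esub> \<otimes>\<^sub>a\<^bsub>T\<^esub> Idt T Y) \<cdot>\<^bsub>T\<^esub> inv_arr T (Assoc T X D Y)))"

definition rigid :: "('o, 'm, 'z) ttcat_scheme \<Rightarrow> 'o \<Rightarrow> bool" where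
  "rigid T X \<longleftrightarrow> X \<in> Ob T \<and> (\<forall>Y \<in> Ob T. iso_arr T (dual_tensor_arr T X Y))"

text \<open>Size. The objects and arrows of a category form HOL sets, so small sets have to be told apart
  from arbitrary ones. A type \<open>'u\<close> plays the role of a universe: a set is small if its cardinality
  is less than that of \<open>'u\<close>. Index sets of (co)products may then be taken to be subsets of \<open>'u\<close>.
  A Grothendieck universe, i.e. inaccessible cardinality of \<open>'u\<close>, gives the usual notions; no
  property of \<open>'u\<close> is imposed, so that every such universe is covered.\<close>

definition small :: "'u itself \<Rightarrow> 'a set \<Rightarrow> bool" where
  "small U I \<longleftrightarrow> I \<prec> (UNIV :: 'u set)"

definition preserves_coproducts ::
    "'u itself \<Rightarrow> ('o, 'm, 'z) cat_scheme \<Rightarrow> ('p, 'n, 'y) cat_scheme \<Rightarrow> ('o, 'm, 'p, 'n) func \<Rightarrow> bool"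
  where
  "preserves_coproducts U C D F \<longleftrightarrow>
     (\<forall>(I :: 'u set) X P \<iota>. small U I \<and> is_coproduct C I X P \<iota>
        \<longrightarrow> is_coproduct D I (FOb F \<circ> X) (FOb F P) (FArr F \<circ> \<iota>))"

definition localizing :: "'u itself \<Rightarrow> ('o, 'm, 'z) tricat_scheme \<Rightarrow> 'o set \<Rightarrow> bool" where
  "localizing U T L \<longleftrightarrow> triangulated_subcategory T L
     \<and> (\<forall>(I :: 'u set) X P \<iota>. small U I \<and> is_coproduct T I X P \<iota> \<and> X ` I \<subseteq> L \<longrightarrow> P \<in> L)"

text \<open>The existence of small products is not an axiom: by Brown representability it is a theorem for
  rigidly-compactly generated categories.\<close>

definition colocalizing :: "'u itself \<Rightarrow> ('o, 'm, 'z) tricat_scheme \<Rightarrow> 'o set \<Rightarrow> bool" where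
  "colocalizing U T L \<longleftrightarrow> triangulated_subcategory T L
     \<and> (\<forall>(I :: 'u set) X P \<pi>. small U I \<and> is_product T I X P \<pi> \<and> X ` I \<subseteq> L \<longrightarrow> P \<in> L)"

definition loc :: "'u itself \<Rightarrow> ('o, 'm, 'z) tricat_scheme \<Rightarrow> 'o set \<Rightarrow> 'o set" where
  "loc U T \<A> = \<Inter> {L. localizing U T L \<and> \<A> \<subseteq> L}"

definition loc_tensor :: "'u itself \<Rightarrow> ('o, 'm, 'z) ttcat_scheme \<Rightarrow> 'o set \<Rightarrow> 'o set" where
  "loc_tensor U T \<A> =
     \<Inter> {L. localizing U T L \<and> (\<forall>X \<in> Ob T. \<forall>Y \<in> L. X \<otimes>\<^sub>o\<^bsub>T\<^esub> Y \<in> L) \<and> \<A> \<subseteq> L}"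

definition coloc_hom :: "'u itself \<Rightarrow> ('o, 'm, 'z) ttcat_scheme \<Rightarrow> 'o set \<Rightarrow> 'o set" where
  "coloc_hom U T \<A> =
     \<Inter> {L. colocalizing U T L \<and> (\<forall>X \<in> Ob T. \<forall>Y \<in> L. IHom T X Y \<in> L) \<and> \<A> \<subseteq> L}"

text \<open>\<open>K\<close> is compact if the canonical map \<open>\<Oplus> Hom(K, X\<^sub>i) \<rightarrow> Hom(K, \<Coprod> X\<^sub>i)\<close> is an isomorphism of
  abelian groups; \<open>sum_group\<close> and \<open>gfinprod\<close> are the direct sum and the sum over a finite support,
  in the multiplicative notation of HOL-Algebra.\<close>

definition compact_object :: "'u itself \<Rightarrow> ('o, 'm, 'z) acat_scheme \<Rightarrow> 'o \<Rightarrow> bool" where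
  "compact_object U T K \<longleftrightarrow> K \<in> Ob T
     \<and> (\<forall>(I :: 'u set) X P \<iota>. small U I \<and> is_coproduct T I X P \<iota> \<longrightarrow>
          (\<lambda>a. gfinprod (Hom_group T K P) (\<lambda>i. \<iota> i \<cdot>\<^bsub>T\<^esub> a i) I)
            \<in> iso (sum_group I (\<lambda>i. Hom_group T K (X i))) (Hom_group T K P))"

locale big_tt_category = closed_tt_category T
  for T :: "('o, 'm, 'z) ttcat_scheme" (structure) +
  fixes U :: "'u itself"
  assumes small_Hom: "\<lbrakk>X \<in> Ob T; Y \<in> Ob T\<rbrakk> \<Longrightarrow> small U (Hom T X Y)"
    and coproducts_exist: "\<lbrakk>small U (I :: 'u set); Xs ` I \<subseteq> Ob T\<rbrakk>
      \<Longrightarrow> \<exists>P \<iota>. is_coproduct T I Xs P \<iota>"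
    and tensor_left_coproducts: "X \<in> Ob T \<Longrightarrow> preserves_coproducts U T T (tensor_left T X)"
    and tensor_right_coproducts: "X \<in> Ob T \<Longrightarrow> preserves_coproducts U T T (tensor_right T X)"
    and compactly_generated: "loc U T {K. compact_object U T K} = Ob T"
    and compacts_essentially_small: "\<exists>R. small U R \<and> R \<subseteq> {K. compact_object U T K}
      \<and> (\<forall>K. compact_object U T K \<longrightarrow> (\<exists>K' \<in> R. isomorphic T K K'))"
    and compacts_triangulated: "triangulated_subcategory T {K. compact_object U T K}"
    and Unit_compact: "compact_object U T \<one>\<^sub>o"
    and TenO_compact: "\<lbrakk>compact_object U T K; compact_object U T L\<rbrakk> \<Longrightarrow> compact_object U T (K \<otimes>\<^sub>o L)"
    and compact_iff_rigid: "compact_object U T K \<longleftrightarrow> rigid T K"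

definition local_to_global ::
    "'u itself \<Rightarrow> ('o, 'm, 'z) ttcat_scheme \<Rightarrow> 's topology \<Rightarrow> ('s \<Rightarrow> 'o) \<Rightarrow> bool" where
  "local_to_global U T S \<Gamma> \<longleftrightarrow>
     (\<forall>A \<in> Ob T. loc_tensor U T {A} = loc_tensor U T {\<Gamma> s \<otimes>\<^sub>o\<^bsub>T\<^esub> A | s. s \<in> topspace S})"

definition colocal_to_global ::
    "'u itself \<Rightarrow> ('o, 'm, 'z) ttcat_scheme \<Rightarrow> 's topology \<Rightarrow> ('s \<Rightarrow> 'o) \<Rightarrow> bool" where
  "colocal_to_global U T S \<Gamma> \<longleftrightarrow>
     (\<forall>A \<in> Ob T. coloc_hom U T {A} = coloc_hom U T {IHom T (\<Gamma> s) A | s. s \<in> topspace S})"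

end

theory Submission
  imports Defs
begin

text \<open>Fix an object \<open>A\<close> and a colocalizing hom-ideal \<open>L\<close>, and look at the class of all \<open>X\<close> with
  \<open>[X, A] \<in> L\<close>. It is a localizing tensor-ideal, because the contravariant functor \<open>[-, A]\<close> turns
  each closure property of \<open>L\<close> into the dual one: it is exact by hypothesis, it sends coproducts
  to products (lemma \<open>hom_into_coproduct\<close>), and \<open>[X \<otimes> Y, A] \<cong> [Y, [X, A]]\<close>
  (lemma \<open>IHom_TenO_isomorphic\<close>).

  If \<open>L\<close> contains every \<open>[\<Gamma>\<^sub>s, A]\<close>, this ideal contains every \<open>\<Gamma>\<^sub>s\<close>. The local-to-global
  principle for the single object \<open>1\<close> says that a localizing tensor-ideal that contains every
  \<open>\<Gamma>\<^sub>s \<otimes> 1 \<cong> \<Gamma>\<^sub>s\<close> also contains \<open>1\<close>. Hence \<open>A \<cong> [1, A] \<in> L\<close>, and so \<open>A\<close> lies in the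
  colocalizing hom-ideal generated by the \<open>[\<Gamma>\<^sub>s, A]\<close>. The other inclusion holds since hom-ideals
  are closed under \<open>[\<Gamma>\<^sub>s, -]\<close>.\<close>

section \<open>Isomorphisms and contravariant functors\<close>

lemma Hom_opposite: "Hom (opposite C) X Y = Hom C Y X"
  by (auto simp: Hom_def opposite_def)

lemma hom_into_simps:
  "FOb (hom_into T A) X = IHom T X A"
  "FArr (hom_into T A) f = IHom_arr T f (Idt T A)"
  by (simp_all add: hom_into_def)

lemma isomorphicI:
  assumes f: "f \<in> Hom C X Y" and "g \<in> Hom C Y X" "g \<cdot>\<^bsub>C\<^esub> f = Idt C X" "f \<cdot>\<^bsub>C\<^esub> g = Idt C Y"
  shows "isomorphic C X Y"
proof -
  have "inverse_arrows C f g" using assms by (simp add: inverse_arrows_def Hom_def)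
  then show ?thesis using f by (auto simp: isomorphic_def iso_arr_def)
qed

context category
begin

lemma Hom_Ob:
  assumes "f \<in> Hom C X Y"
  shows "X \<in> Ob C" "Y \<in> Ob C"
  using assms Dom_in_Ob Cod_in_Ob by (auto simp: Hom_def)

lemma iso_arrE:
  assumes "iso_arr C f" "f \<in> Hom C X Y"
  obtains g where "g \<in> Hom C Y X" "g \<cdot> f = Idt C X" "f \<cdot> g = Idt C Y"
  using assms unfolding iso_arr_def inverse_arrows_def Hom_def by auto

lemma isomorphicE:
  assumes "isomorphic C X Y"
  obtains f g where "f \<in> Hom C X Y" "g \<in> Hom C Y X" "g \<cdot> f = Idt C X" "f \<cdot> g = Idt C Y"
proof -
  obtain f where f: "f \<in> Hom C X Y" "iso_arr C f" using assms unfolding isomorphic_def by blast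
  obtain g where "g \<in> Hom C Y X" "g \<cdot> f = Idt C X" "f \<cdot> g = Idt C Y"
    using f(2,1) by (rule iso_arrE)
  with f(1) show thesis by (rule that)
qed

lemma isomorphic_sym: "isomorphic C X Y \<Longrightarrow> isomorphic C Y X"
  by (erule isomorphicE, rule isomorphicI)

lemma zero_object_is_empty_coproduct:
  "zero_object C Z \<Longrightarrow> is_coproduct C {} X Z \<iota>"
  by (simp add: zero_object_def is_coproduct_def)

lemma contravariant_functor_isomorphic:
  assumes F: "is_functor (opposite C) D F" and iso: "isomorphic C X Y"
  shows "isomorphic D (FOb F X) (FOb F Y)"
proof -
  obtain f g where f: "f \<in> Hom C X Y" and g: "g \<in> Hom C Y X"
    and gf: "g \<cdot> f = Idt C X" and fg: "f \<cdot> g = Idt C Y"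
    using iso by (rule isomorphicE)
  have Ff: "FArr F f \<in> Hom D (FOb F Y) (FOb F X)" and Fg: "FArr F g \<in> Hom D (FOb F X) (FOb F Y)"
    using F f g unfolding is_functor_def Hom_opposite by blast+
  have comp: "FArr F (k \<cdot> h) = FArr F h \<cdot>\<^bsub>D\<^esub> FArr F k"
    if "h \<in> Hom C V W" "k \<in> Hom C W V'" for h k V W V'
  proof -
    have "FArr F (h \<cdot>\<^bsub>opposite C\<^esub> k) = FArr F h \<cdot>\<^bsub>D\<^esub> FArr F k"
      using F that unfolding is_functor_def Hom_opposite by blast
    then show ?thesis by (simp add: opposite_def)
  qed
  have idt: "FArr F (Idt C V) = Idt D (FOb F V)" if "V \<in> Ob C" for V
    using F that unfolding is_functor_def by (simp add: opposite_def)
  have "FArr F f \<cdot>\<^bsub>D\<^esub> FArr F g = Idt D (FOb F X)" "FArr F g \<cdot>\<^bsub>D\<^esub> FArr F f = Idt D (FOb F Y)"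
    using comp[OF f g] comp[OF g f] gf fg idt Hom_Ob[OF f] by simp_all
  then show ?thesis by (rule isomorphicI[OF Fg Ff])
qed

end

section \<open>Internal homs by their universal property\<close>

context tt_category
begin

lemma TenA_Idt_Comp:
  assumes "X \<in> Ob T" "f \<in> Hom T Y Z" "g \<in> Hom T Z W"
  shows "Idt T X \<otimes>\<^sub>a (g \<cdot> f) = (Idt T X \<otimes>\<^sub>a g) \<cdot> (Idt T X \<otimes>\<^sub>a f)"
  using TenA_Comp[OF Idt_in_Hom[OF assms(1)] Idt_in_Hom[OF assms(1)] assms(2,3)]
  by (simp add: Comp_Idt[OF Idt_in_Hom[OF assms(1)]])

lemma TenA_interchange:
  assumes f: "f \<in> Hom T X X'" and g: "g \<in> Hom T Y Y'"
  shows "(f \<otimes>\<^sub>a Idt T Y') \<cdot> (Idt T X \<otimes>\<^sub>a g) = (Idt T X' \<otimes>\<^sub>a g) \<cdot> (f \<otimes>\<^sub>a Idt T Y)"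
proof -
  note Ob = Hom_Ob[OF f] Hom_Ob[OF g]
  have "(f \<otimes>\<^sub>a Idt T Y') \<cdot> (Idt T X \<otimes>\<^sub>a g) = f \<otimes>\<^sub>a g"
    using TenA_Comp[OF Idt_in_Hom[OF Ob(1)] f g Idt_in_Hom[OF Ob(4)]]
    by (simp add: Comp_Idt[OF f] Idt_Comp[OF g])
  moreover have "(Idt T X' \<otimes>\<^sub>a g) \<cdot> (f \<otimes>\<^sub>a Idt T Y) = f \<otimes>\<^sub>a g"
    using TenA_Comp[OF f Idt_in_Hom[OF Ob(2)] Idt_in_Hom[OF Ob(3)] g]
    by (simp add: Comp_Idt[OF g] Idt_Comp[OF f])
  ultimately show ?thesis by simp
qed

lemma TenO_commute: "\<lbrakk>X \<in> Ob T; Y \<in> Ob T\<rbrakk> \<Longrightarrow> isomorphic T (X \<otimes>\<^sub>o Y) (Y \<otimes>\<^sub>o X)"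
  by (rule isomorphicI[OF Braid_in_Hom Braid_in_Hom Braid_symmetric Braid_symmetric])

text \<open>The universal property of \<open>Eval T X A\<close>, stated for an arbitrary object. Canonical
  isomorphisms between internal homs then follow from uniqueness of universal arrows, without
  constructing them by hand.\<close>

definition is_internal_hom :: "'o \<Rightarrow> 'o \<Rightarrow> 'o \<Rightarrow> 'm \<Rightarrow> bool" where
  "is_internal_hom X A H \<epsilon> \<longleftrightarrow> H \<in> Ob T \<and> \<epsilon> \<in> Hom T (X \<otimes>\<^sub>o H) A
     \<and> (\<forall>Y \<in> Ob T. \<forall>f \<in> Hom T (X \<otimes>\<^sub>o Y) A. \<exists>!g. g \<in> Hom T Y H \<and> \<epsilon> \<cdot> (Idt T X \<otimes>\<^sub>a g) = f)"

lemma is_internal_hom_transpose: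
  assumes "is_internal_hom X A H \<epsilon>" "Y \<in> Ob T" "f \<in> Hom T (X \<otimes>\<^sub>o Y) A"
  obtains g where "g \<in> Hom T Y H" "\<epsilon> \<cdot> (Idt T X \<otimes>\<^sub>a g) = f"
  using assms unfolding is_internal_hom_def by metis

lemma is_internal_hom_eqI:
  assumes H: "is_internal_hom X A H \<epsilon>" and X: "X \<in> Ob T"
    and g: "g \<in> Hom T Y H" and g': "g' \<in> Hom T Y H"
    and eq: "\<epsilon> \<cdot> (Idt T X \<otimes>\<^sub>a g) = \<epsilon> \<cdot> (Idt T X \<otimes>\<^sub>a g')"
  shows "g = g'"
proof -
  have \<epsilon>: "\<epsilon> \<in> Hom T (X \<otimes>\<^sub>o H) A" using H by (simp add: is_internal_hom_def)
  have "\<epsilon> \<cdot> (Idt T X \<otimes>\<^sub>a g) \<in> Hom T (X \<otimes>\<^sub>o Y) A"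
    by (rule Comp_in_Hom[OF TenA_in_Hom[OF Idt_in_Hom[OF X] g] \<epsilon>])
  then have "\<exists>!k. k \<in> Hom T Y H \<and> \<epsilon> \<cdot> (Idt T X \<otimes>\<^sub>a k) = \<epsilon> \<cdot> (Idt T X \<otimes>\<^sub>a g)"
    using H Hom_Ob(1)[OF g] by (simp add: is_internal_hom_def)
  then show ?thesis by (rule ex1E) (metis g g' eq)
qed

lemma is_internal_hom_unique:
  assumes H: "is_internal_hom X A H \<epsilon>" and H': "is_internal_hom X A H' \<epsilon>'" and X: "X \<in> Ob T"
  shows "isomorphic T H H'"
proof -
  have ob: "H \<in> Ob T" "H' \<in> Ob T" and \<epsilon>: "\<epsilon> \<in> Hom T (X \<otimes>\<^sub>o H) A" and \<epsilon>': "\<epsilon>' \<in> Hom T (X \<otimes>\<^sub>o H') A"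
    using H H' by (auto simp: is_internal_hom_def)
  obtain u where u: "u \<in> Hom T H H'" "\<epsilon>' \<cdot> (Idt T X \<otimes>\<^sub>a u) = \<epsilon>"
    using is_internal_hom_transpose[OF H' ob(1) \<epsilon>] .
  obtain v where v: "v \<in> Hom T H' H" "\<epsilon> \<cdot> (Idt T X \<otimes>\<^sub>a v) = \<epsilon>'"
    using is_internal_hom_transpose[OF H ob(2) \<epsilon>'] .
  have inverse: "q \<cdot> p = Idt T K"
    if K: "is_internal_hom X A K \<kappa>" and p: "p \<in> Hom T K K'" and q: "q \<in> Hom T K' K"
      and \<kappa>p: "\<kappa>' \<cdot> (Idt T X \<otimes>\<^sub>a p) = \<kappa>" and \<kappa>q: "\<kappa> \<cdot> (Idt T X \<otimes>\<^sub>a q) = \<kappa>'"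
    for K K' \<kappa> \<kappa>' p q
  proof (rule is_internal_hom_eqI[OF K X])
    have obK: "K \<in> Ob T" and \<kappa>: "\<kappa> \<in> Hom T (X \<otimes>\<^sub>o K) A"
      using K by (auto simp: is_internal_hom_def)
    show "q \<cdot> p \<in> Hom T K K" using p q by (rule Comp_in_Hom)
    show "Idt T K \<in> Hom T K K" using obK by (rule Idt_in_Hom)
    have "\<kappa> \<cdot> (Idt T X \<otimes>\<^sub>a (q \<cdot> p)) = \<kappa> \<cdot> (Idt T X \<otimes>\<^sub>a q) \<cdot> (Idt T X \<otimes>\<^sub>a p)"
      using Comp_assoc[OF TenA_in_Hom[OF Idt_in_Hom[OF X] p] TenA_in_Hom[OF Idt_in_Hom[OF X] q] \<kappa>]
      by (simp add: TenA_Idt_Comp[OF X p q])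
    also have "\<dots> = \<kappa> \<cdot> (Idt T X \<otimes>\<^sub>a Idt T K)"
      using \<kappa>p \<kappa>q Comp_Idt[OF \<kappa>] TenA_Idt[OF X obK] by simp
    finally show "\<kappa> \<cdot> (Idt T X \<otimes>\<^sub>a (q \<cdot> p)) = \<kappa> \<cdot> (Idt T X \<otimes>\<^sub>a Idt T K)" .
  qed
  show ?thesis
    using isomorphicI[OF u(1) v(1)] inverse[OF H u(1) v(1) u(2) v(2)] inverse[OF H' v(1) u(1) v(2) u(2)]
    by simp
qed

text \<open>Naturality of the left unitor makes it a universal arrow: the transpose of
  \<open>f : 1 \<otimes> Y \<rightarrow> A\<close> is \<open>f\<close> after the inverse of the unitor of \<open>Y\<close>.\<close>

lemma LUnit_is_internal_hom:
  assumes A: "A \<in> Ob T"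
  shows "is_internal_hom \<one>\<^sub>o A A (LUnit T A)"
  unfolding is_internal_hom_def
proof (intro conjI ballI)
  show "A \<in> Ob T" by fact
  show "LUnit T A \<in> Hom T (\<one>\<^sub>o \<otimes>\<^sub>o A) A" using LUnit_iso[OF A] by simp
next
  fix Y f assume Y: "Y \<in> Ob T" and f: "f \<in> Hom T (\<one>\<^sub>o \<otimes>\<^sub>o Y) A"
  have l: "LUnit T Y \<in> Hom T (\<one>\<^sub>o \<otimes>\<^sub>o Y) Y" using LUnit_iso[OF Y] by simp
  obtain m where m: "m \<in> Hom T Y (\<one>\<^sub>o \<otimes>\<^sub>o Y)"
    and ml: "m \<cdot> LUnit T Y = Idt T (\<one>\<^sub>o \<otimes>\<^sub>o Y)" and lm: "LUnit T Y \<cdot> m = Idt T Y"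
    using LUnit_iso[OF Y] by (blast elim: iso_arrE)
  show "\<exists>!g. g \<in> Hom T Y A \<and> LUnit T A \<cdot> (Idt T \<one>\<^sub>o \<otimes>\<^sub>a g) = f"
  proof (rule ex1I[of _ "f \<cdot> m"])
    have fm: "f \<cdot> m \<in> Hom T Y A" using m f by (rule Comp_in_Hom)
    have "f \<cdot> m \<cdot> LUnit T Y = f"
      using Comp_assoc[OF l m f] ml Comp_Idt[OF f] by simp
    then show "f \<cdot> m \<in> Hom T Y A \<and> LUnit T A \<cdot> (Idt T \<one>\<^sub>o \<otimes>\<^sub>a (f \<cdot> m)) = f"
      using fm LUnit_natural[OF fm] by simp
  next
    fix g assume "g \<in> Hom T Y A \<and> LUnit T A \<cdot> (Idt T \<one>\<^sub>o \<otimes>\<^sub>a g) = f"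
    then have g: "g \<in> Hom T Y A" and "f = g \<cdot> LUnit T Y" using LUnit_natural by auto
    then show "g = f \<cdot> m" using Comp_assoc[OF m l g] lm Comp_Idt[OF g] by simp
  qed
qed

text \<open>Tensor-hom adjunctions compose: the transpose of \<open>(X \<otimes> Y) \<otimes> W \<rightarrow> A\<close> is obtained by first
  moving \<open>X\<close> and then \<open>Y\<close> to the right-hand side.\<close>

lemma iterated_internal_hom:
  assumes X: "X \<in> Ob T" and Y: "Y \<in> Ob T"
    and H: "is_internal_hom X A H \<epsilon>" and K: "is_internal_hom Y H K \<kappa>"
  shows "is_internal_hom (X \<otimes>\<^sub>o Y) A K (\<epsilon> \<cdot> (Idt T X \<otimes>\<^sub>a \<kappa>) \<cdot> Assoc T X Y K)"
proof -
  have obH: "H \<in> Ob T" and \<epsilon>: "\<epsilon> \<in> Hom T (X \<otimes>\<^sub>o H) A"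
    and obK: "K \<in> Ob T" and \<kappa>: "\<kappa> \<in> Hom T (Y \<otimes>\<^sub>o K) H"
    using H K by (auto simp: is_internal_hom_def)
  have assoc: "Assoc T X Y W \<in> Hom T (X \<otimes>\<^sub>o Y \<otimes>\<^sub>o W) (X \<otimes>\<^sub>o (Y \<otimes>\<^sub>o W))" if "W \<in> Ob T" for W
    using Assoc_iso[OF X Y that] by simp
  note IX = Idt_in_Hom[OF X] and IY = Idt_in_Hom[OF Y]
  have X\<kappa>: "Idt T X \<otimes>\<^sub>a \<kappa> \<in> Hom T (X \<otimes>\<^sub>o (Y \<otimes>\<^sub>o K)) (X \<otimes>\<^sub>o H)" by (rule TenA_in_Hom[OF IX \<kappa>])
  have \<epsilon>\<kappa>: "\<epsilon> \<cdot> (Idt T X \<otimes>\<^sub>a \<kappa>) \<in> Hom T (X \<otimes>\<^sub>o (Y \<otimes>\<^sub>o K)) A" by (rule Comp_in_Hom[OF X\<kappa> \<epsilon>])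
  have uncurry: "\<epsilon> \<cdot> (Idt T X \<otimes>\<^sub>a \<kappa>) \<cdot> Assoc T X Y K \<cdot> (Idt T (X \<otimes>\<^sub>o Y) \<otimes>\<^sub>a g)
      = \<epsilon> \<cdot> (Idt T X \<otimes>\<^sub>a (\<kappa> \<cdot> (Idt T Y \<otimes>\<^sub>a g))) \<cdot> Assoc T X Y W"
    if g: "g \<in> Hom T W K" for g W
  proof -
    have W: "W \<in> Ob T" using Hom_Ob[OF g] by simp
    have Yg: "Idt T Y \<otimes>\<^sub>a g \<in> Hom T (Y \<otimes>\<^sub>o W) (Y \<otimes>\<^sub>o K)" by (rule TenA_in_Hom[OF IY g])
    have XYg: "Idt T X \<otimes>\<^sub>a (Idt T Y \<otimes>\<^sub>a g) \<in> Hom T (X \<otimes>\<^sub>o (Y \<otimes>\<^sub>o W)) (X \<otimes>\<^sub>o (Y \<otimes>\<^sub>o K))"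
      by (rule TenA_in_Hom[OF IX Yg])
    have XYg': "Idt T (X \<otimes>\<^sub>o Y) \<otimes>\<^sub>a g \<in> Hom T (X \<otimes>\<^sub>o Y \<otimes>\<^sub>o W) (X \<otimes>\<^sub>o Y \<otimes>\<^sub>o K)"
      by (rule TenA_in_Hom[OF Idt_in_Hom[OF TenO_in_Ob[OF X Y]] g])
    have "\<epsilon> \<cdot> (Idt T X \<otimes>\<^sub>a \<kappa>) \<cdot> Assoc T X Y K \<cdot> (Idt T (X \<otimes>\<^sub>o Y) \<otimes>\<^sub>a g)
        = \<epsilon> \<cdot> (Idt T X \<otimes>\<^sub>a \<kappa>) \<cdot> (Assoc T X Y K \<cdot> (Idt T X \<otimes>\<^sub>a Idt T Y \<otimes>\<^sub>a g))"
      using Comp_assoc[OF XYg' assoc[OF obK] \<epsilon>\<kappa>] by (simp add: TenA_Idt[OF X Y])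
    also have "\<dots> = \<epsilon> \<cdot> (Idt T X \<otimes>\<^sub>a \<kappa>) \<cdot> ((Idt T X \<otimes>\<^sub>a (Idt T Y \<otimes>\<^sub>a g)) \<cdot> Assoc T X Y W)"
      by (simp add: Assoc_natural[OF IX IY g])
    also have "\<dots> = \<epsilon> \<cdot> (Idt T X \<otimes>\<^sub>a \<kappa>) \<cdot> (Idt T X \<otimes>\<^sub>a (Idt T Y \<otimes>\<^sub>a g)) \<cdot> Assoc T X Y W"
      by (rule Comp_assoc[OF assoc[OF W] XYg \<epsilon>\<kappa>])
    also have "\<epsilon> \<cdot> (Idt T X \<otimes>\<^sub>a \<kappa>) \<cdot> (Idt T X \<otimes>\<^sub>a (Idt T Y \<otimes>\<^sub>a g))
        = \<epsilon> \<cdot> (Idt T X \<otimes>\<^sub>a (\<kappa> \<cdot> (Idt T Y \<otimes>\<^sub>a g)))"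
      using Comp_assoc[OF XYg X\<kappa> \<epsilon>] TenA_Idt_Comp[OF X Yg \<kappa>] by simp
    finally show ?thesis .
  qed
  show ?thesis
    unfolding is_internal_hom_def
  proof (intro conjI ballI)
    show "K \<in> Ob T" by fact
    show "\<epsilon> \<cdot> (Idt T X \<otimes>\<^sub>a \<kappa>) \<cdot> Assoc T X Y K \<in> Hom T (X \<otimes>\<^sub>o Y \<otimes>\<^sub>o K) A"
      by (rule Comp_in_Hom[OF assoc[OF obK] \<epsilon>\<kappa>])
  next
    fix W f assume W: "W \<in> Ob T" and f: "f \<in> Hom T (X \<otimes>\<^sub>o Y \<otimes>\<^sub>o W) A"
    obtain b where b: "b \<in> Hom T (X \<otimes>\<^sub>o (Y \<otimes>\<^sub>o W)) (X \<otimes>\<^sub>o Y \<otimes>\<^sub>o W)"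
      and ba: "b \<cdot> Assoc T X Y W = Idt T (X \<otimes>\<^sub>o Y \<otimes>\<^sub>o W)"
      and ab: "Assoc T X Y W \<cdot> b = Idt T (X \<otimes>\<^sub>o (Y \<otimes>\<^sub>o W))"
      using Assoc_iso[OF X Y W] by (blast elim: iso_arrE)
    obtain k where k: "k \<in> Hom T (Y \<otimes>\<^sub>o W) H" and ek: "\<epsilon> \<cdot> (Idt T X \<otimes>\<^sub>a k) = f \<cdot> b"
      using is_internal_hom_transpose[OF H TenO_in_Ob[OF Y W] Comp_in_Hom[OF b f]] .
    obtain g where g: "g \<in> Hom T W K" and kg: "\<kappa> \<cdot> (Idt T Y \<otimes>\<^sub>a g) = k"
      using is_internal_hom_transpose[OF K W k] .
    show "\<exists>!g. g \<in> Hom T W K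
        \<and> \<epsilon> \<cdot> (Idt T X \<otimes>\<^sub>a \<kappa>) \<cdot> Assoc T X Y K \<cdot> (Idt T (X \<otimes>\<^sub>o Y) \<otimes>\<^sub>a g) = f"
    proof (rule ex1I[of _ g], intro conjI)
      show "g \<in> Hom T W K" by fact
      show "\<epsilon> \<cdot> (Idt T X \<otimes>\<^sub>a \<kappa>) \<cdot> Assoc T X Y K \<cdot> (Idt T (X \<otimes>\<^sub>o Y) \<otimes>\<^sub>a g) = f"
        using uncurry[OF g] kg ek Comp_assoc[OF assoc[OF W] b f] ba Comp_Idt[OF f] by simp
    next
      fix g' assume "g' \<in> Hom T W K
        \<and> \<epsilon> \<cdot> (Idt T X \<otimes>\<^sub>a \<kappa>) \<cdot> Assoc T X Y K \<cdot> (Idt T (X \<otimes>\<^sub>o Y) \<otimes>\<^sub>a g') = f"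
      then have g': "g' \<in> Hom T W K"
        and f': "\<epsilon> \<cdot> (Idt T X \<otimes>\<^sub>a (\<kappa> \<cdot> (Idt T Y \<otimes>\<^sub>a g'))) \<cdot> Assoc T X Y W = f"
        using uncurry by auto
      let ?k' = "\<kappa> \<cdot> (Idt T Y \<otimes>\<^sub>a g')"
      have k': "?k' \<in> Hom T (Y \<otimes>\<^sub>o W) H" by (rule Comp_in_Hom[OF TenA_in_Hom[OF IY g'] \<kappa>])
      have \<epsilon>k': "\<epsilon> \<cdot> (Idt T X \<otimes>\<^sub>a ?k') \<in> Hom T (X \<otimes>\<^sub>o (Y \<otimes>\<^sub>o W)) A"
        by (rule Comp_in_Hom[OF TenA_in_Hom[OF IX k'] \<epsilon>])
      have "\<epsilon> \<cdot> (Idt T X \<otimes>\<^sub>a ?k') = \<epsilon> \<cdot> (Idt T X \<otimes>\<^sub>a k)"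
        using Comp_assoc[OF b assoc[OF W] \<epsilon>k'] ab Comp_Idt[OF \<epsilon>k'] f' ek by simp
      then have "?k' = k" by (rule is_internal_hom_eqI[OF H X k' k])
      then have "\<kappa> \<cdot> (Idt T Y \<otimes>\<^sub>a g') = \<kappa> \<cdot> (Idt T Y \<otimes>\<^sub>a g)" using kg by simp
      then show "g' = g" by (rule is_internal_hom_eqI[OF K Y g' g])
    qed
  qed
qed

end

context closed_tt_category
begin

lemma IHom_is_internal_hom:
  "\<lbrakk>X \<in> Ob T; A \<in> Ob T\<rbrakk> \<Longrightarrow> is_internal_hom X A (IHom T X A) (Eval T X A)"
  by (simp add: is_internal_hom_def IHom_in_Ob Eval_in_Hom Eval_universal)

lemma IHom_Unit_isomorphic: "A \<in> Ob T \<Longrightarrow> isomorphic T (IHom T \<one>\<^sub>o A) A"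
  by (rule is_internal_hom_unique[OF IHom_is_internal_hom LUnit_is_internal_hom]) (assumption | rule Unit_in_Ob)+

lemma IHom_TenO_isomorphic:
  assumes "X \<in> Ob T" "Y \<in> Ob T" "A \<in> Ob T"
  shows "isomorphic T (IHom T Y (IHom T X A)) (IHom T (X \<otimes>\<^sub>o Y) A)"
proof -
  note H = IHom_is_internal_hom[OF assms(1,3)]
    and K = IHom_is_internal_hom[OF assms(2) IHom_in_Ob[OF assms(1,3)]]
    and XY = TenO_in_Ob[OF assms(1,2)]
  show ?thesis
    by (rule is_internal_hom_unique[OF iterated_internal_hom[OF assms(1,2) H K]
          IHom_is_internal_hom[OF XY assms(3)] XY])
qed

section \<open>Internal homs out of coproducts\<close>

lemma IHom_arr_precomp:
  assumes f: "f \<in> Hom T X X'" and A: "A \<in> Ob T"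
  shows "IHom_arr T f (Idt T A) \<in> Hom T (IHom T X' A) (IHom T X A)"
    and "Eval T X A \<cdot> (Idt T X \<otimes>\<^sub>a IHom_arr T f (Idt T A))
      = Eval T X' A \<cdot> (f \<otimes>\<^sub>a Idt T (IHom T X' A))"
proof -
  let ?H = "IHom T X' A" and ?e = "Eval T X' A \<cdot> (f \<otimes>\<^sub>a Idt T (IHom T X' A))"
  have X: "X \<in> Ob T" "X' \<in> Ob T" using Hom_Ob[OF f] by auto
  have H: "?H \<in> Ob T" by (rule IHom_in_Ob[OF X(2) A])
  have ev: "Eval T X' A \<in> Hom T (X' \<otimes>\<^sub>o ?H) A" by (rule Eval_in_Hom[OF X(2) A])
  have e: "?e \<in> Hom T (X \<otimes>\<^sub>o ?H) A"
    by (rule Comp_in_Hom[OF TenA_in_Hom[OF f Idt_in_Hom[OF H]] ev])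
  have ends: "Dom T f = X" "Cod T f = X'" "Dom T (Idt T A) = A" "Cod T ?e = A"
    using f e Idt_in_Hom[OF A] by (auto simp: Hom_def)
  have def: "IHom_arr T f (Idt T A)
      = (THE g. g \<in> Hom T ?H (IHom T X A) \<and> Eval T X A \<cdot> (Idt T X \<otimes>\<^sub>a g) = ?e)"
    by (simp add: IHom_arr_def transpose_arr_def ends Let_def Idt_Comp[OF ev])
  show "IHom_arr T f (Idt T A) \<in> Hom T ?H (IHom T X A)"
    "Eval T X A \<cdot> (Idt T X \<otimes>\<^sub>a IHom_arr T f (Idt T A)) = ?e"
    using theI'[OF Eval_universal[OF X(1) H A e]] unfolding def by auto
qed

lemma Eval_IHom_arr_natural:
  assumes f: "f \<in> Hom T X X'" and A: "A \<in> Ob T" and g: "g \<in> Hom T Y (IHom T X' A)"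
  shows "Eval T X A \<cdot> (Idt T X \<otimes>\<^sub>a (IHom_arr T f (Idt T A) \<cdot> g))
    = Eval T X' A \<cdot> (Idt T X' \<otimes>\<^sub>a g) \<cdot> (f \<otimes>\<^sub>a Idt T Y)"
proof -
  let ?H = "IHom T X' A" and ?k = "IHom_arr T f (Idt T A)"
  have X: "X \<in> Ob T" "X' \<in> Ob T" and Y: "Y \<in> Ob T" and H: "?H \<in> Ob T"
    using Hom_Ob[OF f] Hom_Ob[OF g] by auto
  note k = IHom_arr_precomp[OF f A]
  note Xg = TenA_in_Hom[OF Idt_in_Hom[OF X(1)] g] and X'g = TenA_in_Hom[OF Idt_in_Hom[OF X(2)] g]
    and Xk = TenA_in_Hom[OF Idt_in_Hom[OF X(1)] k(1)]
    and fH = TenA_in_Hom[OF f Idt_in_Hom[OF H]] and fY = TenA_in_Hom[OF f Idt_in_Hom[OF Y]]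
  have "Eval T X A \<cdot> (Idt T X \<otimes>\<^sub>a (?k \<cdot> g)) = Eval T X A \<cdot> (Idt T X \<otimes>\<^sub>a ?k) \<cdot> (Idt T X \<otimes>\<^sub>a g)"
    using Comp_assoc[OF Xg Xk Eval_in_Hom[OF X(1) A]] TenA_Idt_Comp[OF X(1) g k(1)] by simp
  also have "\<dots> = Eval T X' A \<cdot> ((f \<otimes>\<^sub>a Idt T ?H) \<cdot> (Idt T X \<otimes>\<^sub>a g))"
    using Comp_assoc[OF Xg fH Eval_in_Hom[OF X(2) A]] k(2) by simp
  also have "\<dots> = Eval T X' A \<cdot> ((Idt T X' \<otimes>\<^sub>a g) \<cdot> (f \<otimes>\<^sub>a Idt T Y))"
    by (simp add: TenA_interchange[OF f g])
  also have "\<dots> = Eval T X' A \<cdot> (Idt T X' \<otimes>\<^sub>a g) \<cdot> (f \<otimes>\<^sub>a Idt T Y)"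
    by (rule Comp_assoc[OF fY X'g Eval_in_Hom[OF X(2) A]])
  finally show ?thesis .
qed

text \<open>A cone \<open>Y \<rightarrow> [X\<^sub>i, A]\<close> transposes to a cocone \<open>X\<^sub>i \<otimes> Y \<rightarrow> A\<close>. Since \<open>- \<otimes> Y\<close> preserves the
  coproduct \<open>P\<close>, the cocone factors uniquely through \<open>P \<otimes> Y\<close>, and transposing back gives the
  unique mediating arrow \<open>Y \<rightarrow> [P, A]\<close>.\<close>

lemma hom_into_coproduct:
  assumes P: "is_coproduct T I X P \<iota>" and A: "A \<in> Ob T"
    and tensor: "\<And>Y. Y \<in> Ob T \<Longrightarrow>
      is_coproduct T I (FOb (tensor_right T Y) \<circ> X) (P \<otimes>\<^sub>o Y) (FArr (tensor_right T Y) \<circ> \<iota>)"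
  shows "is_product T I (\<lambda>i. IHom T (X i) A) (IHom T P A) (\<lambda>i. IHom_arr T (\<iota> i) (Idt T A))"
proof -
  have obP: "P \<in> Ob T" and obX: "\<And>i. i \<in> I \<Longrightarrow> X i \<in> Ob T"
    and \<iota>: "\<And>i. i \<in> I \<Longrightarrow> \<iota> i \<in> Hom T (X i) P"
    using P by (auto simp: is_coproduct_def)
  note evP = Eval_in_Hom[OF obP A] and IP = Idt_in_Hom[OF obP]
  have "\<exists>!h. h \<in> Hom T Y (IHom T P A) \<and> (\<forall>i \<in> I. IHom_arr T (\<iota> i) (Idt T A) \<cdot> h = f i)"
    if Y: "Y \<in> Ob T" and f: "\<And>i. i \<in> I \<Longrightarrow> f i \<in> Hom T Y (IHom T (X i) A)" for Y f
  proof -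
    let ?f = "\<lambda>i. Eval T (X i) A \<cdot> (Idt T (X i) \<otimes>\<^sub>a f i)"
    have "?f i \<in> Hom T (X i \<otimes>\<^sub>o Y) A" if i: "i \<in> I" for i
      using Comp_in_Hom[OF TenA_in_Hom[OF Idt_in_Hom[OF obX[OF i]] f[OF i]] Eval_in_Hom[OF obX[OF i] A]] .
    then have "\<exists>!q. q \<in> Hom T (P \<otimes>\<^sub>o Y) A \<and> (\<forall>i \<in> I. q \<cdot> (\<iota> i \<otimes>\<^sub>a Idt T Y) = ?f i)"
      using tensor[OF Y] A by (simp add: is_coproduct_def tensor_right_def)
    then obtain q where q: "q \<in> Hom T (P \<otimes>\<^sub>o Y) A"
      and qf: "\<And>i. i \<in> I \<Longrightarrow> q \<cdot> (\<iota> i \<otimes>\<^sub>a Idt T Y) = ?f i"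
      and q_unique: "\<And>q'. \<lbrakk>q' \<in> Hom T (P \<otimes>\<^sub>o Y) A;
        \<forall>i \<in> I. q' \<cdot> (\<iota> i \<otimes>\<^sub>a Idt T Y) = ?f i\<rbrakk> \<Longrightarrow> q' = q"
      by metis
    obtain h where h: "h \<in> Hom T Y (IHom T P A)" and hq: "Eval T P A \<cdot> (Idt T P \<otimes>\<^sub>a h) = q"
      using is_internal_hom_transpose[OF IHom_is_internal_hom[OF obP A] Y q] .
    show ?thesis
    proof (rule ex1I[of _ h], intro conjI ballI)
      show "h \<in> Hom T Y (IHom T P A)" by fact
    next
      fix i assume i: "i \<in> I"
      show "IHom_arr T (\<iota> i) (Idt T A) \<cdot> h = f i"
      proof (rule is_internal_hom_eqI[OF IHom_is_internal_hom[OF obX[OF i] A] obX[OF i] _ f[OF i]])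
        show "IHom_arr T (\<iota> i) (Idt T A) \<cdot> h \<in> Hom T Y (IHom T (X i) A)"
          by (rule Comp_in_Hom[OF h IHom_arr_precomp(1)[OF \<iota>[OF i] A]])
        show "Eval T (X i) A \<cdot> (Idt T (X i) \<otimes>\<^sub>a (IHom_arr T (\<iota> i) (Idt T A) \<cdot> h)) = ?f i"
          using Eval_IHom_arr_natural[OF \<iota>[OF i] A h] hq qf[OF i] by simp
      qed
    next
      fix h' assume "h' \<in> Hom T Y (IHom T P A) \<and> (\<forall>i \<in> I. IHom_arr T (\<iota> i) (Idt T A) \<cdot> h' = f i)"
      then have h': "h' \<in> Hom T Y (IHom T P A)"
        and hf: "\<And>i. i \<in> I \<Longrightarrow> IHom_arr T (\<iota> i) (Idt T A) \<cdot> h' = f i" by auto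
      have "Eval T P A \<cdot> (Idt T P \<otimes>\<^sub>a h') = q"
      proof (rule q_unique)
        show "Eval T P A \<cdot> (Idt T P \<otimes>\<^sub>a h') \<in> Hom T (P \<otimes>\<^sub>o Y) A"
          by (rule Comp_in_Hom[OF TenA_in_Hom[OF IP h'] evP])
        show "\<forall>i \<in> I. Eval T P A \<cdot> (Idt T P \<otimes>\<^sub>a h') \<cdot> (\<iota> i \<otimes>\<^sub>a Idt T Y) = ?f i"
          using Eval_IHom_arr_natural[OF \<iota> A h'] hf by simp
      qed
      then show "h' = h"
        using is_internal_hom_eqI[OF IHom_is_internal_hom[OF obP A] obP h' h] hq by simp
    qed
  qed
  then show ?thesis
    by (simp add: is_product_def IHom_in_Ob[OF obP A] IHom_in_Ob[OF obX A]
        IHom_arr_precomp(1)[OF \<iota> A])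
qed

end

section \<open>Pulling back colocalizing hom-ideals along the internal hom\<close>

context big_tt_category
begin

lemma hom_into_small_coproduct:
  fixes I :: "'u set"
  assumes I: "small U I" and P: "is_coproduct T I X P \<iota>" and A: "A \<in> Ob T"
  shows "is_product T I (\<lambda>i. IHom T (X i) A) (IHom T P A) (\<lambda>i. IHom_arr T (\<iota> i) (Idt T A))"
proof (rule hom_into_coproduct[OF P A])
  fix Y assume "Y \<in> Ob T"
  then have "is_coproduct T I (FOb (tensor_right T Y) \<circ> X) (FOb (tensor_right T Y) P)
      (FArr (tensor_right T Y) \<circ> \<iota>)"
    using tensor_right_coproducts I P unfolding preserves_coproducts_def by blast
  then show "is_coproduct T I (FOb (tensor_right T Y) \<circ> X) (P \<otimes>\<^sub>o Y) (FArr (tensor_right T Y) \<circ> \<iota>)"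
    by (simp add: tensor_right_def)
qed

text \<open>Exactness of \<open>[-, A]\<close> gives the closure under shifts and triangles; for shifts it enters as
  the isomorphism \<open>[X, A] \<cong> \<Sigma>[\<Sigma>X, A]\<close>. Zero objects are empty coproducts, which \<open>[-, A]\<close> sends
  to empty products, so they are covered by the closure of \<open>L\<close> under products.\<close>

lemma localizing_hom_preimage:
  assumes exact: "contra_exact_functor T T (hom_into T A)" and A: "A \<in> Ob T"
    and L: "colocalizing U T L"
  shows "localizing U T {X \<in> Ob T. IHom T X A \<in> L}"
proof -
  let ?M = "{X \<in> Ob T. IHom T X A \<in> L}"
  have tri: "triangulated_subcategory T L" using L by (simp add: colocalizing_def)
  have replete: "Y \<in> L" if "X \<in> L" "isomorphic T X Y" for X Y
  proof -
    have "Y \<in> Ob T" using that(2) Hom_Ob(2) unfolding isomorphic_def by blast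
    then show ?thesis using tri that unfolding triangulated_subcategory_def by blast
  qed
  have funct: "is_functor (opposite T) T (hom_into T A)"
    using exact by (simp add: contra_exact_functor_def)
  obtain \<psi> where
    nat: "natural_iso (opposite T) T (hom_into T A)
      (func_comp (Shift T) (func_comp (hom_into T A) (Shift T))) \<psi>"
    and dist: "\<And>f g h. (f, g, h) \<in> Dist T \<Longrightarrow>
      (FArr (hom_into T A) g, FArr (hom_into T A) f,
        ShA T (FArr (hom_into T A) h) \<cdot> \<psi> (Dom T f)) \<in> Dist T"
    using exact unfolding contra_exact_functor_def by metis
  have \<psi>: "\<psi> X \<in> Hom T (IHom T X A) (ShO T (IHom T (ShO T X) A)) \<and> iso_arr T (\<psi> X)"
    if "X \<in> Ob T" for X
    using nat that by (simp add: natural_iso_def opposite_def func_comp_def hom_into_def)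
  have Sh: "is_functor T T (Shift T)" using Shift_equivalence by (simp add: is_equivalence_def)
  have ShO: "ShO T X \<in> Ob T" if "X \<in> Ob T" for X
    using Sh that unfolding is_functor_def by blast
  have coprod: "P \<in> ?M"
    if I: "small U I" and P: "is_coproduct T I X P \<iota>" and X: "X ` I \<subseteq> ?M" for I :: "'u set" and X P \<iota>
  proof -
    have "(\<lambda>i. IHom T (X i) A) ` I \<subseteq> L" using X by auto
    then have "IHom T P A \<in> L"
      using L I hom_into_small_coproduct[OF I P A] unfolding colocalizing_def by blast
    then show ?thesis using P by (simp add: is_coproduct_def)
  qed
  have zero: "Z \<in> ?M" if "zero_object T Z" for Z
  proof (rule coprod)
    show "small U ({} :: 'u set)"
      by (auto simp: small_def lesspoll_def lepoll_def eqpoll_def bij_betw_def)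
    show "is_coproduct T {} undefined Z undefined" by (rule zero_object_is_empty_coproduct[OF that])
  qed simp
  have repl: "Y \<in> ?M" if "X \<in> ?M" "Y \<in> Ob T" "isomorphic T X Y" for X Y
  proof -
    have "isomorphic T (IHom T X A) (IHom T Y A)"
      using contravariant_functor_isomorphic[OF funct that(3)] by (simp add: hom_into_simps)
    then show ?thesis using that replete by blast
  qed
  have shift: "ShO T X \<in> ?M \<longleftrightarrow> X \<in> ?M" if X: "X \<in> Ob T" for X
  proof -
    have iso: "isomorphic T (IHom T X A) (ShO T (IHom T (ShO T X) A))"
      using \<psi>[OF X] unfolding isomorphic_def by blast
    have "IHom T (ShO T X) A \<in> L \<longleftrightarrow> ShO T (IHom T (ShO T X) A) \<in> L"
      using tri IHom_in_Ob[OF ShO[OF X] A] unfolding triangulated_subcategory_def by blast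
    also have "\<dots> \<longleftrightarrow> IHom T X A \<in> L"
      using replete iso isomorphic_sym[OF iso] by blast
    finally show ?thesis using X ShO[OF X] by simp
  qed
  have two_of_three: "(X \<in> ?M \<and> Y \<in> ?M \<longrightarrow> Z \<in> ?M) \<and> (Y \<in> ?M \<and> Z \<in> ?M \<longrightarrow> X \<in> ?M)
      \<and> (X \<in> ?M \<and> Z \<in> ?M \<longrightarrow> Y \<in> ?M)"
    if t: "triangle T X Y Z f g h" and d: "(f, g, h) \<in> Dist T" for X Y Z f g h
  proof -
    let ?F = "\<lambda>k. IHom_arr T k (Idt T A)"
    have ob: "X \<in> Ob T" "Y \<in> Ob T" "Z \<in> Ob T" and f: "f \<in> Hom T X Y" and g: "g \<in> Hom T Y Z"
      and h: "h \<in> Hom T Z (ShO T X)"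
      using t by (auto simp: triangle_def)
    have "ShA T (?F h) \<in> Hom T (ShO T (IHom T (ShO T X) A)) (ShO T (IHom T Z A))"
      using Sh IHom_arr_precomp(1)[OF h A] unfolding is_functor_def by blast
    then have "ShA T (?F h) \<cdot> \<psi> X \<in> Hom T (IHom T X A) (ShO T (IHom T Z A))"
      using \<psi>[OF ob(1)] Comp_in_Hom by blast
    then have "triangle T (IHom T Z A) (IHom T Y A) (IHom T X A) (?F g) (?F f) (ShA T (?F h) \<cdot> \<psi> X)"
      using IHom_arr_precomp(1)[OF f A] IHom_arr_precomp(1)[OF g A] ob IHom_in_Ob A
      by (simp add: triangle_def)
    moreover have "(?F g, ?F f, ShA T (?F h) \<cdot> \<psi> X) \<in> Dist T"
      using dist[OF d] f by (simp add: hom_into_simps Hom_def)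
    ultimately have "(IHom T Z A \<in> L \<and> IHom T Y A \<in> L \<longrightarrow> IHom T X A \<in> L)
        \<and> (IHom T Y A \<in> L \<and> IHom T X A \<in> L \<longrightarrow> IHom T Z A \<in> L)
        \<and> (IHom T Z A \<in> L \<and> IHom T X A \<in> L \<longrightarrow> IHom T Y A \<in> L)"
      using tri unfolding triangulated_subcategory_def by blast
    then show ?thesis using ob by blast
  qed
  have "triangulated_subcategory T ?M"
    unfolding triangulated_subcategory_def
  proof (intro conjI)
    show "\<forall>X Y Z f g h. triangle T X Y Z f g h \<and> (f, g, h) \<in> Dist T
        \<longrightarrow> (X \<in> ?M \<and> Y \<in> ?M \<longrightarrow> Z \<in> ?M) \<and> (Y \<in> ?M \<and> Z \<in> ?M \<longrightarrow> X \<in> ?M)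
          \<and> (X \<in> ?M \<and> Z \<in> ?M \<longrightarrow> Y \<in> ?M)"
      using two_of_three by blast
    show "\<forall>X\<in>?M. \<forall>Y\<in>Ob T. isomorphic T X Y \<longrightarrow> Y \<in> ?M" using repl by blast
    show "\<forall>X\<in>Ob T. ShO T X \<in> ?M \<longleftrightarrow> X \<in> ?M" using shift by blast
  qed (use zero in blast)+
  then show ?thesis using coprod unfolding localizing_def by blast
qed

text \<open>Currying gives \<open>[Y \<otimes> X, A] \<cong> [X, [Y, A]]\<close>, which lies in \<open>L\<close>; the braiding turns
  \<open>Y \<otimes> X\<close> into \<open>X \<otimes> Y\<close>.\<close>

lemma tensor_ideal_hom_preimage:
  assumes funct: "is_functor (opposite T) T (hom_into T A)" and A: "A \<in> Ob T"
    and replete: "\<And>V W. \<lbrakk>V \<in> L; W \<in> Ob T; isomorphic T V W\<rbrakk> \<Longrightarrow> W \<in> L"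
    and ideal: "\<And>X Y. \<lbrakk>X \<in> Ob T; Y \<in> L\<rbrakk> \<Longrightarrow> IHom T X Y \<in> L"
    and X: "X \<in> Ob T" and Y: "Y \<in> Ob T" and YL: "IHom T Y A \<in> L"
  shows "IHom T (X \<otimes>\<^sub>o Y) A \<in> L"
proof -
  have "IHom T (Y \<otimes>\<^sub>o X) A \<in> L"
    by (rule replete[OF ideal[OF X YL] IHom_in_Ob[OF TenO_in_Ob[OF Y X] A]
          IHom_TenO_isomorphic[OF Y X A]])
  moreover have "IHom T (X \<otimes>\<^sub>o Y) A \<in> Ob T"
    by (rule IHom_in_Ob[OF TenO_in_Ob[OF X Y] A])
  moreover have "isomorphic T (IHom T (Y \<otimes>\<^sub>o X) A) (IHom T (X \<otimes>\<^sub>o Y) A)"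
    using contravariant_functor_isomorphic[OF funct TenO_commute[OF Y X]] by (simp add: hom_into_simps)
  ultimately show ?thesis by (rule replete)
qed

text \<open>The localizing tensor-ideal of all \<open>X\<close> with \<open>[X, A] \<in> L\<close> contains \<open>G\<close>, hence by the
  assumption \<open>unit\<close> also \<open>1\<close>, and \<open>[1, A] \<cong> A\<close>. That assumption is what the local-to-global
  principle for the object \<open>1\<close> provides.\<close>

lemma mem_colocalizing_hom_ideal:
  assumes exact: "contra_exact_functor T T (hom_into T A)" and A: "A \<in> Ob T"
    and G: "G \<subseteq> Ob T" and unit: "\<one>\<^sub>o \<in> loc_tensor U T {X \<otimes>\<^sub>o \<one>\<^sub>o | X. X \<in> G}"
    and L: "colocalizing U T L" and ideal: "\<And>X Y. \<lbrakk>X \<in> Ob T; Y \<in> L\<rbrakk> \<Longrightarrow> IHom T X Y \<in> L"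
    and GL: "\<And>X. X \<in> G \<Longrightarrow> IHom T X A \<in> L"
  shows "A \<in> L"
proof -
  let ?M = "{X \<in> Ob T. IHom T X A \<in> L}"
  have funct: "is_functor (opposite T) T (hom_into T A)"
    using exact by (simp add: contra_exact_functor_def)
  have replete: "W \<in> L" if "V \<in> L" "W \<in> Ob T" "isomorphic T V W" for V W
    using L that unfolding colocalizing_def triangulated_subcategory_def by blast
  have "X \<otimes>\<^sub>o \<one>\<^sub>o \<in> ?M" if "X \<in> G" for X
  proof -
    have X: "X \<in> Ob T" using that G by blast
    have "isomorphic T (X \<otimes>\<^sub>o \<one>\<^sub>o) X" using RUnit_iso[OF X] unfolding isomorphic_def by blast
    then have "isomorphic T (IHom T X A) (IHom T (X \<otimes>\<^sub>o \<one>\<^sub>o) A)"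
      using contravariant_functor_isomorphic[OF funct isomorphic_sym] by (simp add: hom_into_simps)
    then have "IHom T (X \<otimes>\<^sub>o \<one>\<^sub>o) A \<in> L"
      by (rule replete[OF GL[OF that] IHom_in_Ob[OF TenO_in_Ob[OF X Unit_in_Ob] A]])
    then show ?thesis using TenO_in_Ob[OF X Unit_in_Ob] by blast
  qed
  moreover have "X \<otimes>\<^sub>o Y \<in> ?M" if X: "X \<in> Ob T" and "Y \<in> ?M" for X Y
  proof -
    have Y: "Y \<in> Ob T" and YL: "IHom T Y A \<in> L" using that(2) by simp_all
    have "IHom T (X \<otimes>\<^sub>o Y) A \<in> L"
      by (rule tensor_ideal_hom_preimage[OF funct A _ _ X Y YL]) (fact replete, fact ideal)
    then show ?thesis using TenO_in_Ob[OF X Y] by simp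
  qed
  ultimately have "\<one>\<^sub>o \<in> ?M"
    using unit localizing_hom_preimage[OF exact A L] unfolding loc_tensor_def by blast
  then have "IHom T \<one>\<^sub>o A \<in> L" by simp
  then show ?thesis using A IHom_Unit_isomorphic[OF A] by (rule replete)
qed

end

section \<open>From local-to-global to colocal-to-global\<close>

theorem corollary3p28:
  fixes T :: "('o, 'm, 'z) ttcat_scheme"
    and U :: "'u itself"
    and S :: "'s topology"
    and \<Gamma> :: "'s \<Rightarrow> 'o"
  assumes "big_tt_category T U"
    and "hom_triangulated_in_first_variable T"
    and "\<And>s. s \<in> topspace S \<Longrightarrow> \<Gamma> s \<in> Ob T"
    and "\<And>s. s \<in> topspace S \<Longrightarrow> \<not> zero_object T (\<Gamma> s)"
    and "local_to_global U T S \<Gamma>"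
  shows "colocal_to_global U T S \<Gamma>"
proof -
  interpret big_tt_category T U by fact
  let ?G = "\<Gamma> ` topspace S"
  have G: "?G \<subseteq> Ob T" using assms(3) by blast
  have "\<one>\<^sub>o\<^bsub>T\<^esub> \<in> loc_tensor U T {\<one>\<^sub>o\<^bsub>T\<^esub>}" by (simp add: loc_tensor_def)
  also have "loc_tensor U T {\<one>\<^sub>o\<^bsub>T\<^esub>} = loc_tensor U T {\<Gamma> s \<otimes>\<^sub>o\<^bsub>T\<^esub> \<one>\<^sub>o\<^bsub>T\<^esub> | s. s \<in> topspace S}"
    using assms(5) Unit_in_Ob unfolding local_to_global_def by blast
  also have "{\<Gamma> s \<otimes>\<^sub>o\<^bsub>T\<^esub> \<one>\<^sub>o\<^bsub>T\<^esub> | s. s \<in> topspace S} = {X \<otimes>\<^sub>o\<^bsub>T\<^esub> \<one>\<^sub>o\<^bsub>T\<^esub> | X. X \<in> ?G}"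
    by blast
  finally have unit: "\<one>\<^sub>o\<^bsub>T\<^esub> \<in> loc_tensor U T {X \<otimes>\<^sub>o\<^bsub>T\<^esub> \<one>\<^sub>o\<^bsub>T\<^esub> | X. X \<in> ?G}" .
  have "coloc_hom U T {A} = coloc_hom U T {IHom T (\<Gamma> s) A | s. s \<in> topspace S}"
    if A: "A \<in> Ob T" for A
  proof -
    have exact: "contra_exact_functor T T (hom_into T A)"
      using assms(2) A by (simp add: hom_triangulated_in_first_variable_def)
    have "A \<in> L \<longleftrightarrow> {IHom T (\<Gamma> s) A | s. s \<in> topspace S} \<subseteq> L"
      if L: "colocalizing U T L" and ideal: "\<forall>X \<in> Ob T. \<forall>Y \<in> L. IHom T X Y \<in> L" for L
    proof
      assume "A \<in> L"
      then show "{IHom T (\<Gamma> s) A | s. s \<in> topspace S} \<subseteq> L" using ideal assms(3) by blast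
    next
      assume "{IHom T (\<Gamma> s) A | s. s \<in> topspace S} \<subseteq> L"
      then show "A \<in> L"
        using mem_colocalizing_hom_ideal[OF exact A G unit L] ideal by blast
    qed
    then show ?thesis unfolding coloc_hom_def by (intro arg_cong[where f = Inter]) auto
  qed
  then show ?thesis by (simp add: colocal_to_global_def)
qed

end
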